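(* Let $k_1,k_2\ge1$ be integers. For all $n\ge k_1+k_2$, $$P_{q,\theta}(W_L=n)=P^{(1)}_{q,L}(n)+P^{(0)}_{q,L}(n),$$ where $$P^{(1)}_{q,L}(n)=\sum_{i=k_2}^{n-k_1}\theta^{n-i}q^{ik_1}\prod_{j=1}^{i}(1-\theta q^{j-1})\sum_{s=1}^{i-k_2+1}\Big[E_{q,0,k_2}^{k_1,\infty}(n-k_1-i,i,s)+F_{q,0,k_2}^{k_1,\infty}(n-k_1-i,i,s)\Big]$$ and $$P^{(0)}_{q,L}(n)=\sum_{i=k_1}^{n-k_2}\theta^{i}\prod_{j=1}^{n-i}(1-\theta q^{j-1})\sum_{s=1}^{i-k_1+1}\Big[G_{q,k_1,0}^{\infty,k_2}(i,n-k_2-i,s)+H_{q,k_1,0}^{\infty,k_2}(i,n-k_2-i,s)\Big].$$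
   Context: Model: fix reals $0\le\theta\le1$ and $0<q<1$. $(X_j)_{j\ge1}$ is a sequence of $\{0,1\}$-valued random variables (1 = success, 0 = failure) with law $P_{q,\theta}$ such that, conditionally on $X_1,\dots,X_{j-1}$ containing exactly $i-1$ zeros, $X_j=0$ with probability $1-\theta q^{i-1}$ and $X_j=1$ with probability $\theta q^{i-1}$. Conventions: $0^0=1$, empty products are 1, empty sums are 0. Waiting times: $T_1$ is the least $n\ge k_1$ with $X_{n-k_1+1}=\dots=X_n=1$; $T_0$ is the least $n\ge k_2$ with $X_{n-k_2+1}=\dots=X_n=0$ ($\infty$ if none). $W_L=\max(T_1,T_0)$ is the later waiting time; $P^{(1)}_{q,L}(n)=P_{q,\theta}(T_1=n,\ T_0<n)$ and $P^{(0)}_{q,L}(n)=P_{q,\theta}(T_0=n,\ T_1<n)$. $S_{r,s}^{k}$ denotes the set of $s$-tuples of positive integers with sum $r$ and maximum $>k$ (for $k=0$ the maximum condition is vacuous, and $S_{0,0}^0$ consists of the empty tuple). Combinatorial sums, for integers $m,r$ and $s\ge1$: - $E_{q,0,k_2}^{k_1,\infty}(m,r,s)=\sum q^{\sum_{j=1}^{s-1}(y_1+\dots+y_j)x_j}$ over $(x_1,\dots,x_{s-1})\in S_{m,s-1}^0$ with all $x_j<k_1$ and $(y_1,\dots,y_s)\in S_{r,s}^{k_2-1}$; - $F_{q,0,k_2}^{k_1,\infty}(m,r,s)=\sum q^{\sum_{j=2}^{s}(y_1+\dots+y_{j-1})x_j}$ over $(x_1,\dots,x_s)\in S_{m,s}^0$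 with all $x_j<k_1$ and $(y_1,\dots,y_s)\in S_{r,s}^{k_2-1}$; - $G_{q,k_1,0}^{\infty,k_2}(m,r,s)=\sum q^{\sum_{j=2}^{s}(y_1+\dots+y_{j-1})x_j}$ over $(x_1,\dots,x_s)\in S_{m,s}^{k_1-1}$ and $(y_1,\dots,y_{s-1})\in S_{r,s-1}^0$ with all $y_j<k_2$; - $H_{q,k_1,0}^{\infty,k_2}(m,r,s)=\sum q^{\sum_{j=1}^{s}(y_1+\dots+y_j)x_j}$ over $(x_1,\dots,x_s)\in S_{m,s}^{k_1-1}$ and $(y_1,\dots,y_s)\in S_{r,s}^0$ with all $y_j<k_2$. *)

theory Defs
  imports "HOL-Probability.Probability"
begin

text \<open>Trials are indexed by the positive integers; the variable \<open>X 0\<close> is never used.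
  The conditioning is on the full history \<open>X 1 = x 1, \<dots>, X (j - 1) = x (j - 1)\<close>, whose number of
  zeros is \<open>i - 1\<close>; conditioning only on the number of zeros would not determine the law of \<open>X\<close>.
  Histories of probability zero (which occur for \<open>\<theta> = 0\<close> and \<open>\<theta> = 1\<close>) impose nothing.\<close>

locale q_binary_trials = prob_space M
  for M :: "'a measure" and X :: "nat \<Rightarrow> 'a \<Rightarrow> nat" and q \<theta> :: real +
  assumes measurable_trial:
      "\<And>j. j \<ge> 1 \<Longrightarrow> X j \<in> measurable M (count_space UNIV)"
    and binary_trial:
      "\<And>j \<omega>. j \<ge> 1 \<Longrightarrow> \<omega> \<in> space M \<Longrightarrow> X j \<omega> \<in> {0, 1}"
    and cond_prob_failure:
      "\<And>j x. j \<ge> 1 \<Longrightarrow> \<P>(\<omega> in M. \<forall>l\<in>{1..<j}. X l \<omega> = x l) > 0 \<Longrightarrow>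
        \<P>(\<omega> in M. X j \<omega> = 0 \<bar> \<forall>l\<in>{1..<j}. X l \<omega> = x l)
          = 1 - \<theta> * q ^ card {l \<in> {1..<j}. x l = 0}"
    and cond_prob_success:
      "\<And>j x. j \<ge> 1 \<Longrightarrow> \<P>(\<omega> in M. \<forall>l\<in>{1..<j}. X l \<omega> = x l) > 0 \<Longrightarrow>
        \<P>(\<omega> in M. X j \<omega> = 1 \<bar> \<forall>l\<in>{1..<j}. X l \<omega> = x l)
          = \<theta> * q ^ card {l \<in> {1..<j}. x l = 0}"

definition run_ends_at :: "(nat \<Rightarrow> nat) \<Rightarrow> nat \<Rightarrow> nat \<Rightarrow> nat \<Rightarrow> bool" where
  "run_ends_at x v k n \<longleftrightarrow> n \<ge> k \<and> (\<forall>l\<in>{n - k + 1..n}. x l = v)"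

definition waiting_time :: "(nat \<Rightarrow> nat) \<Rightarrow> nat \<Rightarrow> nat \<Rightarrow> enat" where
  "waiting_time x v k =
    (if \<exists>n. run_ends_at x v k n then enat (LEAST n. run_ends_at x v k n) else \<infinity>)"

definition T1 :: "(nat \<Rightarrow> 'a \<Rightarrow> nat) \<Rightarrow> nat \<Rightarrow> 'a \<Rightarrow> enat" where
  "T1 X k1 \<omega> = waiting_time (\<lambda>j. X j \<omega>) 1 k1"

definition T0 :: "(nat \<Rightarrow> 'a \<Rightarrow> nat) \<Rightarrow> nat \<Rightarrow> 'a \<Rightarrow> enat" where
  "T0 X k2 \<omega> = waiting_time (\<lambda>j. X j \<omega>) 0 k2"

definition WL :: "(nat \<Rightarrow> 'a \<Rightarrow> nat) \<Rightarrow> nat \<Rightarrow> nat \<Rightarrow> 'a \<Rightarrow> enat" where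
  "WL X k1 k2 \<omega> = max (T1 X k1 \<omega>) (T0 X k2 \<omega>)"

definition PL1 :: "'a measure \<Rightarrow> (nat \<Rightarrow> 'a \<Rightarrow> nat) \<Rightarrow> nat \<Rightarrow> nat \<Rightarrow> nat \<Rightarrow> real" where
  "PL1 M X k1 k2 n = \<P>(\<omega> in M. T1 X k1 \<omega> = enat n \<and> T0 X k2 \<omega> < enat n)"

definition PL0 :: "'a measure \<Rightarrow> (nat \<Rightarrow> 'a \<Rightarrow> nat) \<Rightarrow> nat \<Rightarrow> nat \<Rightarrow> nat \<Rightarrow> real" where
  "PL0 M X k1 k2 n = \<P>(\<omega> in M. T0 X k2 \<omega> = enat n \<and> T1 X k1 \<omega> < enat n)"

text \<open>Tuples are lists, so the component written \<open>x\<^sub>j\<close> (with \<open>j\<close> starting at 1) is \<open>xs ! (j - 1)\<close>,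
  and \<open>y\<^sub>1 + \<dots> + y\<^sub>j\<close> is \<open>sum_list (take j ys)\<close>. For \<open>k > 0\<close> the empty tuple is excluded.\<close>

definition S :: "nat \<Rightarrow> nat \<Rightarrow> nat \<Rightarrow> nat list set" where
  "S r s k = {xs. length xs = s \<and> (\<forall>x\<in>set xs. x > 0) \<and> sum_list xs = r \<and>
    (k = 0 \<or> xs \<noteq> [] \<and> Max (set xs) > k)}"

lemma finite_S: "finite (S r s k)"
proof (rule finite_subset)
  show "S r s k \<subseteq> {xs. set xs \<subseteq> {..r} \<and> length xs = s}"
    by (auto simp: S_def intro: member_le_sum_list)
qed (rule finite_lists_length_eq, simp)

definition E :: "real \<Rightarrow> nat \<Rightarrow> nat \<Rightarrow> nat \<Rightarrow> nat \<Rightarrow> nat \<Rightarrow> real" where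
  "E q k1 k2 m r s =
    (\<Sum>(xs, ys) \<in> {xs \<in> S m (s - 1) 0. \<forall>x\<in>set xs. x < k1} \<times> S r s (k2 - 1).
      q ^ (\<Sum>j = 1..s - 1. sum_list (take j ys) * xs ! (j - 1)))"

definition F :: "real \<Rightarrow> nat \<Rightarrow> nat \<Rightarrow> nat \<Rightarrow> nat \<Rightarrow> nat \<Rightarrow> real" where
  "F q k1 k2 m r s =
    (\<Sum>(xs, ys) \<in> {xs \<in> S m s 0. \<forall>x\<in>set xs. x < k1} \<times> S r s (k2 - 1).
      q ^ (\<Sum>j = 2..s. sum_list (take (j - 1) ys) * xs ! (j - 1)))"

definition G :: "real \<Rightarrow> nat \<Rightarrow> nat \<Rightarrow> nat \<Rightarrow> nat \<Rightarrow> nat \<Rightarrow> real" where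
  "G q k1 k2 m r s =
    (\<Sum>(xs, ys) \<in> S m s (k1 - 1) \<times> {ys \<in> S r (s - 1) 0. \<forall>y\<in>set ys. y < k2}.
      q ^ (\<Sum>j = 2..s. sum_list (take (j - 1) ys) * xs ! (j - 1)))"

definition H :: "real \<Rightarrow> nat \<Rightarrow> nat \<Rightarrow> nat \<Rightarrow> nat \<Rightarrow> nat \<Rightarrow> real" where
  "H q k1 k2 m r s =
    (\<Sum>(xs, ys) \<in> S m s (k1 - 1) \<times> {ys \<in> S r s 0. \<forall>y\<in>set ys. y < k2}.
      q ^ (\<Sum>j = 1..s. sum_list (take j ys) * xs ! (j - 1)))"

end

theory Submission
  imports Defs "HOL-Library.Sublist"
begin

text \<open>
  An outcome of the first \<open>n\<close> trials is a word over \<open>bool\<close> (\<open>True\<close> for success). By the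
  multiplication rule a word with \<open>a\<close> successes and \<open>b\<close> failures has probability
  \<open>\<theta> ^ a * (\<Prod>j = 1..b. 1 - \<theta> * q ^ (j - 1)) * q ^ e\<close>, where \<open>e\<close> is the number of pairs of a
  failure and a later success (\<open>prob_trials_eq\<close>): the failures meet the factors
  \<open>1 - \<theta> * q ^ (j - 1)\<close> in turn, and a success after \<open>z\<close> failures has the factor \<open>\<theta> * q ^ z\<close>.

  The success run is the later one and ends at trial \<open>n\<close> exactly if the word is \<open>u\<close> followed by
  \<open>k1\<close> successes, where \<open>u\<close> ends in a failure, has no success run of length \<open>k1\<close> and has a failure run
  of length \<open>k2\<close> (\<open>final_run_iff\<close>). If \<open>u\<close> has \<open>i\<close> failures, the appended successes add
  \<open>i * k1\<close> to the exponent, so only the sum of \<open>q ^ inversions u\<close> over the words \<open>u\<close> with given letter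
  counts remains to be computed. A word is the same thing as its first letter together with the lengths of its
  runs (\<open>alternate_inj\<close>, \<open>alternate_surj\<close>); the run lengths are two compositions, the length conditions
  on runs are bounds on the parts (\<open>sublist_alternate\<close>), and the exponent is bilinear in them
  (\<open>inversions_alternate\<close>). Sorting by the number of failure runs and the first letter gives the sums \<open>E\<close>
  and \<open>F\<close>.

  The case where the failure run is the later one is the same with the two letters exchanged, and leads to
  \<open>G\<close> and \<open>H\<close>; failures at the end do not change the exponent but enter the product. Both cases are
  therefore treated at once (\<open>sum_pre_run_words\<close>, \<open>sum_final_run_words\<close>) for a final letter \<open>c\<close>.
\<close>

section \<open>Inversions of words\<close>

text \<open>The exponent of \<open>q\<close> contributed by a finite outcome. A success at a moment when \<open>z\<close> failures have
  occurred carries the factor \<open>\<theta> * q ^ z\<close>; summed over all successes, \<open>z\<close> gives the number of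
  pairs of a failure and a later success.\<close>

fun inversions :: "bool list \<Rightarrow> nat" where
  "inversions [] = 0"
| "inversions (b # w) = (if b then 0 else count_list w True) + inversions w"

lemma inversions_append:
  "inversions (u @ w) = inversions u + inversions w + count_list u False * count_list w True"
  by (induction u) (auto simp: algebra_simps)

lemma inversions_replicate [simp]: "inversions (replicate k v) = 0"
  by (induction k) (auto simp: count_list_0_iff)

lemma length_eq_count_list: "length u = count_list u c + count_list u (\<not> c)"
  by (cases c; induction u) auto

lemma count_list_replicate: "count_list (replicate k a) b = (if a = b then k else 0)"
  by (induction k) auto

section \<open>Words as alternating runs\<close>

text \<open>The word whose maximal runs have the lengths \<open>xs\<close> (runs of \<open>v\<close>) and \<open>ys\<close> (runs of \<open>\<not> v\<close>),
  interleaved, with a run of \<open>v\<close> first. Exchanging the two lists in the recursive call makes the four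
  shapes that occur (first and last letter given) instances of one function.\<close>

function alternate :: "bool \<Rightarrow> nat list \<Rightarrow> nat list \<Rightarrow> bool list" where
  "alternate v [] ys = []"
| "alternate v (x # xs) ys = replicate x v @ alternate (\<not> v) ys xs"
  by pat_completeness auto
termination
  by (relation "Wellfounded.measure (\<lambda>(v, xs, ys). length xs + length ys)") auto

text \<open>The first list belongs to the letter of the first run, so it has as many entries as the second list
  or one more, according to the letter of the last run.\<close>

definition is_run_lengths :: "nat list \<Rightarrow> nat list \<Rightarrow> bool" where
  "is_run_lengths xs ys \<longleftrightarrow> (\<forall>x\<in>set xs \<union> set ys. 0 < x) \<and>
     length ys \<le> length xs \<and> length xs \<le> Suc (length ys)"

lemma is_run_lengths_Nil [simp]: "is_run_lengths [] ys \<longleftrightarrow> ys = []"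
  by (auto simp: is_run_lengths_def)

lemma is_run_lengths_Cons [simp]: "is_run_lengths (x # xs) ys \<longleftrightarrow> 0 < x \<and> is_run_lengths ys xs"
  by (auto simp: is_run_lengths_def)

lemma hd_alternate: "is_run_lengths xs ys \<Longrightarrow> xs \<noteq> [] \<Longrightarrow> alternate v xs ys \<noteq> [] \<and> hd (alternate v xs ys) = v"
  by (cases xs) (auto simp: hd_append)

lemma alternate_eq_Nil_iff: "is_run_lengths xs ys \<Longrightarrow> alternate v xs ys = [] \<longleftrightarrow> xs = []"
  by (cases xs) auto

lemma last_alternate:
  "is_run_lengths xs ys \<Longrightarrow> xs \<noteq> [] \<Longrightarrow> last (alternate v xs ys) = (v \<longleftrightarrow> length xs \<noteq> length ys)"
proof (induction v xs ys rule: alternate.induct)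
  case (2 v x xs ys)
  show ?case
  proof (cases "ys = []")
    case True
    with 2 show ?thesis by (auto simp: is_run_lengths_def)
  next
    case False
    with 2 have "last (alternate (\<not> v) ys xs) = (\<not> v \<longleftrightarrow> length ys \<noteq> length xs)"
      and "alternate (\<not> v) ys xs \<noteq> []" by (auto simp: alternate_eq_Nil_iff)
    with 2 show ?thesis by (auto simp: is_run_lengths_def)
  qed
qed auto

lemma count_alternate:
  "is_run_lengths xs ys \<Longrightarrow> count_list (alternate v xs ys) v = sum_list xs
     \<and> count_list (alternate v xs ys) (\<not> v) = sum_list ys"
  by (induction v xs ys rule: alternate.induct) (auto simp: count_list_replicate)

text \<open>A success run is preceded by exactly the failures in the failure runs before it, so it contributes
  its length times a partial sum of failure run lengths. That partial sum has one more term when the word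
  starts with failures. These are the exponents of the four combinatorial sums.\<close>

lemma inversions_alternate:
  "is_run_lengths xs ys \<Longrightarrow> inversions (alternate v xs ys) =
     (if v then \<Sum>j<length xs. sum_list (take j ys) * xs ! j
      else \<Sum>j<length ys. sum_list (take (Suc j) xs) * ys ! j)"
proof (induction v xs ys rule: alternate.induct)
  case (2 v x xs ys)
  then have IH: "is_run_lengths ys xs" "inversions (alternate (\<not> v) ys xs) =
     (if \<not> v then \<Sum>j<length ys. sum_list (take j xs) * ys ! j
      else \<Sum>j<length xs. sum_list (take (Suc j) ys) * xs ! j)" by auto
  have *: "sum_list ys = (\<Sum>j<length ys. ys ! j)"
    by (simp add: sum_list_sum_nth atLeast0LessThan)
  from IH count_alternate[of ys xs "\<not> v"] show ?case
    by (cases v) (simp_all add: inversions_append count_list_replicate sum.lessThan_Suc_shift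
        * sum_distrib_left sum.distrib algebra_simps del: sum.lessThan_Suc)
qed auto

text \<open>The remainder \<open>w\<close> does not prolong the leading run of \<open>v\<close>, so a block of \<open>v\<close> lies either inside the
  leading run or inside \<open>w\<close>.\<close>

lemma sublist_replicate_same:
  assumes "w = [] \<or> hd w \<noteq> v"
  shows "sublist (replicate k v) (replicate x v @ w) \<longleftrightarrow> k \<le> x \<or> sublist (replicate k v) w"
proof (induction x)
  case 0
  then show ?case by auto
next
  case (Suc x)
  have "prefix (replicate k v) (replicate y v @ w) \<longleftrightarrow> k \<le> y" for y
  proof (induction y arbitrary: k)
    case 0
    then show ?case using assms by (cases k; cases w) auto
  next
    case (Suc y)
    then show ?case by (cases k) auto
  qed
  from this[of "Suc x"] Suc show ?case by (auto simp: sublist_Cons_right)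
qed

lemma sublist_replicate_other:
  assumes "v \<noteq> c" "0 < k"
  shows "sublist (replicate k c) (replicate x v @ w) \<longleftrightarrow> sublist (replicate k c) w"
  using assms by (induction x) (auto simp: sublist_Cons_right gr0_conv_Suc)

text \<open>Runs of one letter are separated by nonempty runs of the other, so a block of \<open>k\<close> equal letters
  must lie inside a single run. This turns conditions on waiting times into bounds on the parts.\<close>

lemma sublist_alternate:
  assumes "is_run_lengths xs ys" "0 < k"
  shows "sublist (replicate k v) (alternate v xs ys) \<longleftrightarrow> (\<exists>x\<in>set xs. k \<le> x)"
    and "sublist (replicate k (\<not> v)) (alternate v xs ys) \<longleftrightarrow> (\<exists>y\<in>set ys. k \<le> y)"
proof -
  have "(sublist (replicate k v) (alternate v xs ys) \<longleftrightarrow> (\<exists>x\<in>set xs. k \<le> x)) \<and>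
        (sublist (replicate k (\<not> v)) (alternate v xs ys) \<longleftrightarrow> (\<exists>y\<in>set ys. k \<le> y))"
    using assms
  proof (induction v xs ys rule: alternate.induct)
    case (2 v x xs ys)
    from 2 have "alternate (\<not> v) ys xs = [] \<or> hd (alternate (\<not> v) ys xs) \<noteq> v"
      by (cases "ys = []") (auto simp: hd_alternate)
    from 2 sublist_replicate_same[OF this] show ?case
      by (auto simp: sublist_replicate_other)
  qed auto
  then show "sublist (replicate k v) (alternate v xs ys) \<longleftrightarrow> (\<exists>x\<in>set xs. k \<le> x)"
    and "sublist (replicate k (\<not> v)) (alternate v xs ys) \<longleftrightarrow> (\<exists>y\<in>set ys. k \<le> y)"
    by blast+
qed

lemma replicate_append_eq_iff:
  assumes "u = [] \<or> hd u \<noteq> v" "w = [] \<or> hd w \<noteq> v"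
  shows "replicate x v @ u = replicate y v @ w \<longleftrightarrow> x = y \<and> u = w"
proof -
  have "length (takeWhile (\<lambda>b. b = v) (replicate z v @ t)) = z" if "t = [] \<or> hd t \<noteq> v" for z t
    using that by (induction z) (cases t; auto)+
  with assms show ?thesis by (metis append_eq_append_conv)
qed

text \<open>Together with \<open>alternate_surj\<close> this identifies the words starting with \<open>v\<close> with their lists of run
  lengths. In both proofs the first run is split off.\<close>

lemma alternate_inj:
  "is_run_lengths xs ys \<Longrightarrow> is_run_lengths xs' ys' \<Longrightarrow> alternate v xs ys = alternate v xs' ys' \<Longrightarrow>
   xs = xs' \<and> ys = ys'"
proof (induction v xs ys arbitrary: xs' ys' rule: alternate.induct)
  case (1 v ys)
  then show ?case by (metis alternate.simps(1) alternate_eq_Nil_iff is_run_lengths_Nil)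
next
  case (2 v x xs ys)
  then obtain x' zs where xs': "xs' = x' # zs"
    by (cases xs') auto
  from 2(2,3) have ys: "is_run_lengths ys xs" "is_run_lengths ys' zs"
    by (simp_all add: xs')
  have *: "alternate (\<not> v) a b = [] \<or> hd (alternate (\<not> v) a b) \<noteq> v" if "is_run_lengths a b" for a b
    using that by (cases "a = []") (auto simp: hd_alternate)
  from 2(4) have "x = x' \<and> alternate (\<not> v) ys xs = alternate (\<not> v) ys' zs"
    using replicate_append_eq_iff[OF *[OF ys(1)] *[OF ys(2)]] by (simp add: xs')
  with 2(1)[OF ys] xs' show ?case by simp
qed

lemma alternate_surj:
  "w = [] \<or> hd w = v \<Longrightarrow> \<exists>xs ys. is_run_lengths xs ys \<and> w = alternate v xs ys"
proof (induction "length w" arbitrary: w v rule: less_induct)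
  case less
  show ?case
  proof (cases "w = []")
    case True
    then show ?thesis by (intro exI[of _ "[]"]) auto
  next
    case False
    define t where "t = dropWhile (\<lambda>b. b = v) w"
    define x where "x = length (takeWhile (\<lambda>b. b = v) w)"
    have "takeWhile (\<lambda>b. b = v) w = replicate x v"
      unfolding x_def by (metis (mono_tags) replicate_length_same set_takeWhileD)
    then have w: "w = replicate x v @ t"
      unfolding t_def by (metis takeWhile_dropWhile_id)
    have x: "0 < x" using False less.prems unfolding x_def by (cases w) auto
    have "t = [] \<or> hd t = (\<not> v)"
      unfolding t_def using hd_dropWhile by blast
    with less.hyps[of t "\<not> v"] w x obtain xs ys where
      "is_run_lengths xs ys" "t = alternate (\<not> v) xs ys" by auto
    with w x show ?thesis by (intro exI[of _ "x # ys"] exI[of _ xs]) auto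
  qed
qed

section \<open>Words before the final run\<close>

text \<open>The outcomes that can precede a final run of \<open>k\<close> letters \<open>c\<close> when that run is the first one of
  its length and a run of \<open>l\<close> opposite letters has been seen before, sorted by their letter counts. The
  last letter differs from \<open>c\<close>, since otherwise a run of length \<open>k\<close> would be completed earlier.\<close>

definition pre_run_words :: "bool \<Rightarrow> nat \<Rightarrow> nat \<Rightarrow> nat \<Rightarrow> nat \<Rightarrow> bool list set" where
  "pre_run_words c k l m r = {u. u \<noteq> [] \<and> last u \<noteq> c \<and>
     \<not> sublist (replicate k c) u \<and> sublist (replicate l (\<not> c)) u \<and>
     count_list u c = m \<and> count_list u (\<not> c) = r}"

definition short_parts :: "nat \<Rightarrow> nat \<Rightarrow> nat \<Rightarrow> nat list set" where
  "short_parts m s k = {xs \<in> S m s 0. \<forall>x\<in>set xs. x < k}"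

lemma short_parts_iff: "xs \<in> short_parts m s k \<longleftrightarrow> length xs = s \<and> (\<forall>x\<in>set xs. 0 < x) \<and> sum_list xs = m \<and> \<not> (\<exists>x\<in>set xs. k \<le> x)"
  by (auto simp: short_parts_def S_def not_le)

text \<open>For \<open>l = 1\<close> the condition on the maximum in \<open>S\<close> is vacuous, but then every part is at least
  \<open>l\<close>, so this case needs no separate treatment.\<close>

lemma S_long_iff:
  assumes "1 \<le> l" "1 \<le> s"
  shows "ys \<in> S r s (l - Suc 0) \<longleftrightarrow> length ys = s \<and> (\<forall>y\<in>set ys. 0 < y) \<and> sum_list ys = r \<and> (\<exists>y\<in>set ys. l \<le> y)"
proof (cases "ys = []")
  case True
  with assms show ?thesis by (auto simp: S_def)
next
  case False
  have "l - 1 < y \<longleftrightarrow> l \<le> y" for y using assms by auto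
  with False have "Max (set ys) > l - 1 \<longleftrightarrow> (\<exists>y\<in>set ys. l \<le> y)"
    by (subst Max_gr_iff) auto
  moreover have "\<exists>y. y \<in> set ys" using False by (cases ys) auto
  ultimately show ?thesis using False assms by (auto simp: S_def Suc_le_eq)
qed

lemma length_le_sum_list: "\<forall>y\<in>set ys. 0 < y \<Longrightarrow> length ys \<le> sum_list (ys::nat list)"
  by (induction ys) auto

text \<open>One part is at least \<open>l\<close> and the others are at least 1. This is where the upper limit \<open>r - l + 1\<close>
  on the number of parts comes from.\<close>

lemma long_part_bounds_length:
  "\<forall>y\<in>set ys. 0 < y \<Longrightarrow> y \<in> set ys \<Longrightarrow> l \<le> y \<Longrightarrow> length ys + l \<le> Suc (sum_list (ys::nat list))"
proof (induction ys)
  case (Cons a ys)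
  then show ?case using length_le_sum_list[of ys] by fastforce
qed auto

lemma finite_short_parts: "finite (short_parts m s k)"
  by (simp add: short_parts_def finite_S)

text \<open>The words in question end with the letter opposite to \<open>c\<close>. If they also start with it, they have one
  run of \<open>c\<close> fewer than runs of the other letter; if they start with \<open>c\<close>, the numbers agree.\<close>

lemma alternate_in_pre_run_words_other:
  assumes "1 \<le> k" "1 \<le> l" and d: "is_run_lengths ys xs" and ne: "ys \<noteq> []"
  shows "alternate (\<not> c) ys xs \<in> pre_run_words c k l m r \<longleftrightarrow>
    (\<exists>s\<in>{1..r - l + 1}. ys \<in> S r s (l - 1) \<and> xs \<in> short_parts m (s - 1) k)" (is "?u \<in> _ \<longleftrightarrow> ?R")
proof -
  have pos: "\<forall>x\<in>set xs. 0 < x" "\<forall>y\<in>set ys. 0 < y"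
    and len: "length xs \<le> length ys" "length ys \<le> Suc (length xs)"
    using d by (auto simp: is_run_lengths_def)
  have "?u \<in> pre_run_words c k l m r \<longleftrightarrow> length xs = length ys - 1 \<and> \<not> (\<exists>x\<in>set xs. k \<le> x) \<and>
      (\<exists>y\<in>set ys. l \<le> y) \<and> sum_list xs = m \<and> sum_list ys = r"
  proof -
    have "last ?u \<noteq> c \<longleftrightarrow> length xs = length ys - 1"
      unfolding last_alternate[OF d ne] using len ne by (cases ys) auto
    then show ?thesis
      using alternate_eq_Nil_iff[OF d] ne assms(1,2) count_alternate[OF d, of "\<not> c"]
        sublist_alternate[OF d, of k "\<not> c"] sublist_alternate[OF d, of l "\<not> c"]
      by (simp add: pre_run_words_def)
  qed
  also have "\<dots> \<longleftrightarrow> ?R"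
  proof
    assume L: "length xs = length ys - 1 \<and> \<not> (\<exists>x\<in>set xs. k \<le> x) \<and>
      (\<exists>y\<in>set ys. l \<le> y) \<and> sum_list xs = m \<and> sum_list ys = r"
    then have "length ys + l \<le> Suc r" using pos long_part_bounds_length by blast
    with ne have "length ys \<in> {1..r - l + 1}" by (cases ys) auto
    with L pos assms(2) show ?R by (intro bexI[of _ "length ys"]) (simp_all add: S_long_iff short_parts_iff)
  next
    assume ?R
    then obtain s where "1 \<le> s" "ys \<in> S r s (l - 1)" and "xs \<in> short_parts m (s - 1) k" by auto
    with S_long_iff[OF assms(2), of s] show "length xs = length ys - 1 \<and> \<not> (\<exists>x\<in>set xs. k \<le> x) \<and>
      (\<exists>y\<in>set ys. l \<le> y) \<and> sum_list xs = m \<and> sum_list ys = r"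
      by (simp add: short_parts_iff)
  qed
  finally show ?thesis .
qed

lemma alternate_in_pre_run_words_same:
  assumes "1 \<le> k" "1 \<le> l" and d: "is_run_lengths xs ys" and ne: "xs \<noteq> []"
  shows "alternate c xs ys \<in> pre_run_words c k l m r \<longleftrightarrow>
    (\<exists>s\<in>{1..r - l + 1}. ys \<in> S r s (l - 1) \<and> xs \<in> short_parts m s k)" (is "?u \<in> _ \<longleftrightarrow> ?R")
proof -
  have pos: "\<forall>x\<in>set xs. 0 < x" "\<forall>y\<in>set ys. 0 < y"
    using d by (auto simp: is_run_lengths_def)
  have "?u \<in> pre_run_words c k l m r \<longleftrightarrow> length xs = length ys \<and> \<not> (\<exists>x\<in>set xs. k \<le> x) \<and>
      (\<exists>y\<in>set ys. l \<le> y) \<and> sum_list xs = m \<and> sum_list ys = r"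
  proof -
    have "last ?u \<noteq> c \<longleftrightarrow> length xs = length ys"
      unfolding last_alternate[OF d ne] by auto
    then show ?thesis
      using alternate_eq_Nil_iff[OF d] ne assms(1,2) count_alternate[OF d, of c]
        sublist_alternate[OF d, of k c] sublist_alternate[OF d, of l c]
      by (simp add: pre_run_words_def)
  qed
  also have "\<dots> \<longleftrightarrow> ?R"
  proof
    assume L: "length xs = length ys \<and> \<not> (\<exists>x\<in>set xs. k \<le> x) \<and>
      (\<exists>y\<in>set ys. l \<le> y) \<and> sum_list xs = m \<and> sum_list ys = r"
    then have "length ys + l \<le> Suc r" using pos long_part_bounds_length by blast
    with ne L have "length ys \<in> {1..r - l + 1}" by (cases ys) auto
    with L pos assms(2) show ?R by (intro bexI[of _ "length ys"]) (simp_all add: S_long_iff short_parts_iff)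
  next
    assume ?R
    then obtain s where "1 \<le> s" "ys \<in> S r s (l - 1)" and "xs \<in> short_parts m s k" by auto
    with S_long_iff[OF assms(2), of s] show "length xs = length ys \<and> \<not> (\<exists>x\<in>set xs. k \<le> x) \<and>
      (\<exists>y\<in>set ys. l \<le> y) \<and> sum_list xs = m \<and> sum_list ys = r"
      by (simp add: short_parts_iff)
  qed
  finally show ?thesis .
qed

lemma bij_alternate:
  "bij_betw (\<lambda>(xs, ys). alternate v xs ys)
     {(xs, ys). is_run_lengths xs ys \<and> xs \<noteq> [] \<and> alternate v xs ys \<in> A} {u \<in> A. u \<noteq> [] \<and> hd u = v}"
proof (rule bij_betw_imageI)
  show "inj_on (\<lambda>(xs, ys). alternate v xs ys)
     {(xs, ys). is_run_lengths xs ys \<and> xs \<noteq> [] \<and> alternate v xs ys \<in> A}"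
    by (rule inj_onI) (auto dest: alternate_inj)
  show "(\<lambda>(xs, ys). alternate v xs ys) ` {(xs, ys). is_run_lengths xs ys \<and> xs \<noteq> [] \<and> alternate v xs ys \<in> A}
      = {u \<in> A. u \<noteq> [] \<and> hd u = v}"
  proof (intro equalityI subsetI)
    fix u assume u: "u \<in> {u \<in> A. u \<noteq> [] \<and> hd u = v}"
    then obtain xs ys where "is_run_lengths xs ys" "u = alternate v xs ys"
      using alternate_surj[of u v] by auto
    with u show "u \<in> (\<lambda>(xs, ys). alternate v xs ys) ` {(xs, ys). is_run_lengths xs ys \<and> xs \<noteq> [] \<and> alternate v xs ys \<in> A}"
      by (intro image_eqI[of _ _ "(xs, ys)"]) auto
  qed (auto simp: hd_alternate)
qed

lemma finite_pre_run_words: "finite (pre_run_words c k l m r)"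
proof (rule finite_subset)
  show "pre_run_words c k l m r \<subseteq> {u. set u \<subseteq> UNIV \<and> length u = m + r}"
    unfolding pre_run_words_def using length_eq_count_list by blast
qed (rule finite_lists_length_eq, simp)

text \<open>The words are split by their first letter and by the number \<open>s\<close> of runs of \<open>\<not> c\<close>. Within one class
  the run lengths of the two letters vary independently, \<open>c\<close> having only short runs and \<open>\<not> c\<close>
  at least one long run.\<close>

lemma sum_pre_run_words:
  assumes "1 \<le> k" "1 \<le> l"
  shows "(\<Sum>u\<in>pre_run_words c k l m r. f u) = (\<Sum>s = 1..r - l + 1.
     (\<Sum>xs\<in>short_parts m (s - 1) k. \<Sum>ys\<in>S r s (l - 1). f (alternate (\<not> c) ys xs)) +
     (\<Sum>xs\<in>short_parts m s k. \<Sum>ys\<in>S r s (l - 1). f (alternate c xs ys) :: real))"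
proof -
  define A where "A = pre_run_words c k l m r"
  have ne: "u \<noteq> []" if "u \<in> A" for u using that by (auto simp: A_def pre_run_words_def)
  have "(\<Sum>u\<in>A. f u) = (\<Sum>u\<in>{u \<in> A. u \<noteq> [] \<and> hd u = (\<not> c)} \<union> {u \<in> A. u \<noteq> [] \<and> hd u = c}. f u)"
    using ne by (intro sum.cong refl) blast
  also have "\<dots> = (\<Sum>u | u \<in> A \<and> u \<noteq> [] \<and> hd u = (\<not> c). f u) + (\<Sum>u | u \<in> A \<and> u \<noteq> [] \<and> hd u = c. f u)"
    by (rule sum.union_disjoint) (auto simp: A_def finite_pre_run_words)
  also have "(\<Sum>u | u \<in> A \<and> u \<noteq> [] \<and> hd u = (\<not> c). f u) =
      (\<Sum>(ys, xs) | is_run_lengths ys xs \<and> ys \<noteq> [] \<and> alternate (\<not> c) ys xs \<in> A. f (alternate (\<not> c) ys xs))"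
    by (subst sum.reindex_bij_betw[OF bij_alternate, symmetric]) (simp add: case_prod_unfold)
  also have "{(ys, xs). is_run_lengths ys xs \<and> ys \<noteq> [] \<and> alternate (\<not> c) ys xs \<in> A} =
      (\<Union>s\<in>{1..r - l + 1}. S r s (l - 1) \<times> short_parts m (s - 1) k)"
  proof -
    have "is_run_lengths ys xs \<and> ys \<noteq> []" if "s \<in> {1..r - l + 1}" "ys \<in> S r s (l - 1)" "xs \<in> short_parts m (s - 1) k" for s xs ys
      using that assms by (auto simp: S_long_iff short_parts_iff is_run_lengths_def)
    with alternate_in_pre_run_words_other[OF assms, of _ _ c m r] show ?thesis unfolding A_def by blast
  qed
  also have "(\<Sum>(ys, xs)\<in>(\<Union>s\<in>{1..r - l + 1}. S r s (l - 1) \<times> short_parts m (s - 1) k). f (alternate (\<not> c) ys xs)) =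
      (\<Sum>s = 1..r - l + 1. \<Sum>(ys, xs)\<in>S r s (l - 1) \<times> short_parts m (s - 1) k. f (alternate (\<not> c) ys xs))"
    using assms by (intro sum.UNION_disjoint) (auto intro!: finite_cartesian_product finite_S finite_short_parts simp: S_long_iff)
  also have "\<dots> = (\<Sum>s = 1..r - l + 1. \<Sum>xs\<in>short_parts m (s - 1) k. \<Sum>ys\<in>S r s (l - 1). f (alternate (\<not> c) ys xs))"
    by (subst sum.swap) (simp add: sum.cartesian_product)
  also have "(\<Sum>u | u \<in> A \<and> u \<noteq> [] \<and> hd u = c. f u) =
      (\<Sum>(xs, ys) | is_run_lengths xs ys \<and> xs \<noteq> [] \<and> alternate c xs ys \<in> A. f (alternate c xs ys))"
    by (subst sum.reindex_bij_betw[OF bij_alternate, symmetric]) (simp add: case_prod_unfold)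
  also have "{(xs, ys). is_run_lengths xs ys \<and> xs \<noteq> [] \<and> alternate c xs ys \<in> A} =
      (\<Union>s\<in>{1..r - l + 1}. short_parts m s k \<times> S r s (l - 1))"
  proof -
    have "is_run_lengths xs ys \<and> xs \<noteq> []" if "s \<in> {1..r - l + 1}" "ys \<in> S r s (l - 1)" "xs \<in> short_parts m s k" for s xs ys
      using that assms by (auto simp: S_long_iff short_parts_iff is_run_lengths_def)
    with alternate_in_pre_run_words_same[OF assms, of _ _ c m r] show ?thesis unfolding A_def by blast
  qed
  also have "(\<Sum>(xs, ys)\<in>(\<Union>s\<in>{1..r - l + 1}. short_parts m s k \<times> S r s (l - 1)). f (alternate c xs ys)) =
      (\<Sum>s = 1..r - l + 1. \<Sum>(xs, ys)\<in>short_parts m s k \<times> S r s (l - 1). f (alternate c xs ys))"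
    using assms by (intro sum.UNION_disjoint) (auto intro!: finite_cartesian_product finite_S finite_short_parts simp: S_long_iff)
  finally show ?thesis
    by (simp add: A_def sum.cartesian_product sum.distrib)
qed

lemma is_run_lengths_of_parts:
  assumes "1 \<le> l" "1 \<le> s" "ys \<in> S r s (l - 1)"
  shows "xs \<in> short_parts m s k \<Longrightarrow> is_run_lengths xs ys" "xs \<in> short_parts m (s - 1) k \<Longrightarrow> is_run_lengths ys xs"
  using assms by (auto simp: S_long_iff short_parts_iff is_run_lengths_def)

text \<open>For a word that starts with a success run, the first run has no failure before it; dropping its vanishing
  term gives the summation range \<open>2..s\<close>.\<close>

lemma sum_from_2_shift:
  fixes f :: "nat \<Rightarrow> nat"
  assumes "f 0 = 0"
  shows "(\<Sum>j = 2..s. f (j - 1)) = (\<Sum>j<s. f j)"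
  by (induction s) (auto simp: assms not_less_eq Suc_le_eq)

text \<open>The words before a final success run end with a failure: \<open>E\<close> collects those that start with a failure,
  \<open>F\<close> those that start with a success.\<close>

lemma E_F_words:
  assumes "1 \<le> k1" "1 \<le> k2"
  shows "(\<Sum>u\<in>pre_run_words True k1 k2 m r. q ^ inversions u) =
    (\<Sum>s = 1..r - k2 + 1. E q k1 k2 m r s + F q k1 k2 m r s)"
proof -
  have "(\<Sum>xs\<in>short_parts m (s - 1) k1. \<Sum>ys\<in>S r s (k2 - 1). q ^ inversions (alternate (\<not> True) ys xs)) = E q k1 k2 m r s"
    if "1 \<le> s" for s
    unfolding E_def short_parts_def[symmetric] sum.cartesian_product
  proof (intro sum.cong refl, clarify)
    fix xs ys assume *: "xs \<in> short_parts m (s - 1) k1" "ys \<in> S r s (k2 - 1)"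
    then have "length xs = s - 1" by (simp add: short_parts_iff)
    then show "q ^ inversions (alternate (\<not> True) ys xs) = q ^ (\<Sum>j = 1..s - 1. sum_list (take j ys) * xs ! (j - 1))"
      using is_run_lengths_of_parts(2)[OF assms(2) that *(2,1)]
      by (simp add: inversions_alternate sum.atLeast1_atMost_eq)
  qed
  moreover have "(\<Sum>xs\<in>short_parts m s k1. \<Sum>ys\<in>S r s (k2 - 1). q ^ inversions (alternate True xs ys)) = F q k1 k2 m r s"
    if "1 \<le> s" for s
    unfolding F_def short_parts_def[symmetric] sum.cartesian_product
  proof (intro sum.cong refl, clarify)
    fix xs ys assume *: "xs \<in> short_parts m s k1" "ys \<in> S r s (k2 - 1)"
    then have "length xs = s" by (simp add: short_parts_iff)
    then show "q ^ inversions (alternate True xs ys) = q ^ (\<Sum>j = 2..s. sum_list (take (j - 1) ys) * xs ! (j - 1))"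
      using is_run_lengths_of_parts(1)[OF assms(2) that *(2,1)]
      sum_from_2_shift[of "\<lambda>j. sum_list (take j ys) * xs ! j" s]
      by (simp add: inversions_alternate)
  qed
  ultimately show ?thesis
    unfolding sum_pre_run_words[OF assms] by (intro sum.cong) auto
qed

text \<open>The words before a final failure run end with a success: \<open>G\<close> collects those that start with a success,
  \<open>H\<close> those that start with a failure.\<close>

lemma G_H_words:
  assumes "1 \<le> k1" "1 \<le> k2"
  shows "(\<Sum>u\<in>pre_run_words False k2 k1 r m. q ^ inversions u) =
    (\<Sum>s = 1..m - k1 + 1. G q k1 k2 m r s + H q k1 k2 m r s)"
proof -
  have swap: "(\<Sum>ys\<in>B. \<Sum>xs\<in>A. g xs ys) = (\<Sum>(xs, ys)\<in>A \<times> B. g xs ys)"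
    for A B :: "nat list set" and g :: "nat list \<Rightarrow> nat list \<Rightarrow> real"
    by (subst sum.swap) (simp add: sum.cartesian_product)
  have "(\<Sum>ys\<in>short_parts r (s - 1) k2. \<Sum>xs\<in>S m s (k1 - 1). q ^ inversions (alternate (\<not> False) xs ys)) = G q k1 k2 m r s"
    if "1 \<le> s" for s
    unfolding G_def short_parts_def[symmetric] swap[of "\<lambda>xs ys. q ^ inversions (alternate (\<not> False) xs ys)"]
  proof (intro sum.cong refl, clarify)
    fix xs ys assume *: "ys \<in> short_parts r (s - 1) k2" "xs \<in> S m s (k1 - 1)"
    then have "length xs = s" by (simp add: S_def)
    then show "q ^ inversions (alternate (\<not> False) xs ys) = q ^ (\<Sum>j = 2..s. sum_list (take (j - 1) ys) * xs ! (j - 1))"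
      using is_run_lengths_of_parts(2)[OF assms(1) that *(2,1)]
      sum_from_2_shift[of "\<lambda>j. sum_list (take j ys) * xs ! j" s]
      by (simp add: inversions_alternate)
  qed
  moreover have "(\<Sum>ys\<in>short_parts r s k2. \<Sum>xs\<in>S m s (k1 - 1). q ^ inversions (alternate False ys xs)) = H q k1 k2 m r s"
    if "1 \<le> s" for s
    unfolding H_def short_parts_def[symmetric] swap[of "\<lambda>xs ys. q ^ inversions (alternate False ys xs)"]
  proof (intro sum.cong refl, clarify)
    fix xs ys assume *: "ys \<in> short_parts r s k2" "xs \<in> S m s (k1 - 1)"
    then have "length xs = s" by (simp add: S_def)
    then show "q ^ inversions (alternate False ys xs) = q ^ (\<Sum>j = 1..s. sum_list (take j ys) * xs ! (j - 1))"
      using is_run_lengths_of_parts(1)[OF assms(1) that *(2,1)]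
      by (simp add: inversions_alternate sum.atLeast1_atMost_eq)
  qed
  ultimately show ?thesis
    unfolding sum_pre_run_words[OF assms(2,1)] by (intro sum.cong) auto
qed

section \<open>Waiting times in terms of words\<close>

definition word :: "(nat \<Rightarrow> nat) \<Rightarrow> nat \<Rightarrow> bool list" where
  "word x n = map (\<lambda>j. x j = 1) [1..<Suc n]"

lemma word_0 [simp]: "word x 0 = []"
  by (simp add: word_def)

lemma word_Suc [simp]: "word x (Suc n) = word x n @ [x (Suc n) = 1]"
  by (simp add: word_def)

lemma length_word [simp]: "length (word x n) = n"
  by (simp add: word_def)

lemma run_ends_at_iff_suffix:
  assumes "\<forall>j\<ge>1. x j \<in> {0, 1}"
  shows "run_ends_at x (of_bool c) k n \<longleftrightarrow> suffix (replicate k c) (word x n)"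
proof (induction n arbitrary: k)
  case 0
  show ?case by (cases k) (auto simp: run_ends_at_def)
next
  case (Suc n)
  show ?case
  proof (cases k)
    case 0
    then show ?thesis by (simp add: run_ends_at_def)
  next
    case (Suc k')
    have "run_ends_at x (of_bool c) (Suc k') (Suc n) \<longleftrightarrow>
        x (Suc n) = of_bool c \<and> run_ends_at x (of_bool c) k' n"
    proof -
      have "{Suc n - Suc k' + 1..Suc n} = insert (Suc n) {n - k' + 1..n}" by auto
      then show ?thesis by (simp add: run_ends_at_def conj_ac)
    qed
    also have "x (Suc n) = of_bool c \<longleftrightarrow> (x (Suc n) = 1) = c"
      using assms[rule_format, of "Suc n"] by (cases c) auto
    also have "((x (Suc n) = 1) = c \<and> run_ends_at x (of_bool c) k' n) \<longleftrightarrow>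
        suffix (replicate k' c @ [c]) (word x n @ [x (Suc n) = 1])"
      unfolding Suc.IH[of k'] snoc_suffix_snoc by blast
    finally show ?thesis by (simp add: Suc replicate_append_same)
  qed
qed

lemma run_ends_by_iff_sublist:
  assumes "\<forall>j\<ge>1. x j \<in> {0, 1}"
  shows "(\<exists>m\<le>n. run_ends_at x (of_bool c) k m) \<longleftrightarrow> sublist (replicate k c) (word x n)"
proof (induction n)
  case 0
  show ?case by (simp add: run_ends_at_iff_suffix[OF assms])
next
  case (Suc n)
  have "(\<exists>m\<le>Suc n. run_ends_at x (of_bool c) k m) \<longleftrightarrow>
      run_ends_at x (of_bool c) k (Suc n) \<or> (\<exists>m\<le>n. run_ends_at x (of_bool c) k m)"
    by (auto simp: le_Suc_eq)
  then show ?case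
    unfolding Suc.IH unfolding run_ends_at_iff_suffix[OF assms] by (simp add: sublist_snoc)
qed

lemma waiting_time_less_iff: "waiting_time x v k < enat n \<longleftrightarrow> (\<exists>m<n. run_ends_at x v k m)"
proof (cases "\<exists>m. run_ends_at x v k m")
  case True
  then have "run_ends_at x v k (LEAST m. run_ends_at x v k m)" by (rule LeastI_ex)
  with True show ?thesis
    by (auto simp: waiting_time_def intro: le_less_trans[OF Least_le])
qed (simp add: waiting_time_def)

lemma waiting_time_eq_iff:
  "waiting_time x v k = enat n \<longleftrightarrow> run_ends_at x v k n \<and> \<not> (\<exists>m<n. run_ends_at x v k m)"
proof (cases "\<exists>m. run_ends_at x v k m")
  case True
  have "(LEAST m. run_ends_at x v k m) = n \<longleftrightarrow> run_ends_at x v k n \<and> \<not> (\<exists>m<n. run_ends_at x v k m)"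
    using LeastI_ex[OF True] not_less_Least[of _ "run_ends_at x v k"]
    by (metis linorder_neqE_nat)
  with True show ?thesis by (simp add: waiting_time_def)
qed (simp add: waiting_time_def)

lemma waiting_time_word:
  assumes "\<forall>j\<ge>1. x j \<in> {0, 1}" "0 < n"
  shows "waiting_time x (of_bool c) k < enat n \<longleftrightarrow> sublist (replicate k c) (butlast (word x n))"
    and "waiting_time x (of_bool c) k = enat n \<longleftrightarrow>
      suffix (replicate k c) (word x n) \<and> \<not> sublist (replicate k c) (butlast (word x n))"
proof -
  obtain n' where n: "n = Suc n'" using assms(2) by (cases n) auto
  have "(\<exists>m<n. run_ends_at x (of_bool c) k m) \<longleftrightarrow> sublist (replicate k c) (butlast (word x n))"
    using run_ends_by_iff_sublist[of x n' c k, OF assms(1)] by (simp add: n less_Suc_eq_le)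
  then show "waiting_time x (of_bool c) k < enat n \<longleftrightarrow> sublist (replicate k c) (butlast (word x n))"
    and "waiting_time x (of_bool c) k = enat n \<longleftrightarrow>
      suffix (replicate k c) (word x n) \<and> \<not> sublist (replicate k c) (butlast (word x n))"
    unfolding waiting_time_less_iff waiting_time_eq_iff run_ends_at_iff_suffix[OF assms(1)] by simp_all
qed

lemma sublist_append_replicate_other:
  assumes "v \<noteq> c" "0 < k"
  shows "sublist (replicate k c) (w @ replicate x v) \<longleftrightarrow> sublist (replicate k c) w"
  using sublist_replicate_other[OF assms, of x "rev w"]
  by (metis rev_append rev_replicate rev_rev_ident sublist_rev)

text \<open>The appended letters are one short of a full run, so a full run that uses some of them also uses the
  last letter of \<open>w\<close>.\<close>

lemma sublist_append_replicate_short: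
  "sublist (replicate (Suc k) c) (w @ replicate k c) \<longleftrightarrow>
     sublist (replicate (Suc k) c) w \<or> (w \<noteq> [] \<and> last w = c)"
proof (cases "w \<noteq> [] \<and> last w = c")
  case True
  then obtain w' where "w = w' @ [c]" by (metis append_butlast_last_id)
  then show ?thesis by simp
next
  case False
  then have "rev w = [] \<or> hd (rev w) \<noteq> c" by (auto simp: hd_rev)
  from sublist_replicate_same[OF this, of "Suc k" k] False
  show ?thesis
    by (metis Suc_n_not_le_n rev_append rev_replicate rev_rev_ident sublist_rev)
qed

text \<open>The first condition says that a run of \<open>k\<close> letters \<open>c\<close> ends with the word, the other two concern runs
  completed strictly earlier, hence inside \<open>butlast w\<close>. The \<open>k - 1\<close> letters of the final run that
  remain in \<open>butlast w\<close> matter only if \<open>u\<close> ends in \<open>c\<close>, and then a run of \<open>c\<close> is completed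
  too early.\<close>

lemma final_run_iff:
  assumes "1 \<le> k" "1 \<le> l"
  shows "suffix (replicate k c) w \<and> \<not> sublist (replicate k c) (butlast w) \<and>
      sublist (replicate l (\<not> c)) (butlast w) \<longleftrightarrow>
    (\<exists>u. w = u @ replicate k c \<and> u \<noteq> [] \<and> last u \<noteq> c \<and>
       \<not> sublist (replicate k c) u \<and> sublist (replicate l (\<not> c)) u)"
proof -
  obtain k' where k: "k = Suc k'" using assms by (cases k) auto
  have bl: "butlast (u @ replicate k c) = u @ replicate k' c" for u
    by (simp add: k butlast_append flip: replicate_append_same)
  have "\<not> sublist (replicate k c) (butlast (u @ replicate k c)) \<and>
      sublist (replicate l (\<not> c)) (butlast (u @ replicate k c)) \<longleftrightarrow>
      u \<noteq> [] \<and> last u \<noteq> c \<and> \<not> sublist (replicate k c) u \<and> sublist (replicate l (\<not> c)) u" for u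
  proof -
    have "sublist (replicate l (\<not> c)) (u @ replicate k' c) \<longleftrightarrow> sublist (replicate l (\<not> c)) u"
      using assms by (intro sublist_append_replicate_other) auto
    moreover have "\<not> sublist (replicate l (\<not> c)) []" using assms by (cases l) auto
    ultimately show ?thesis
      unfolding bl unfolding k sublist_append_replicate_short by blast
  qed
  then show ?thesis unfolding suffix_def by blast
qed

definition final_run_words :: "bool \<Rightarrow> nat \<Rightarrow> nat \<Rightarrow> nat \<Rightarrow> bool list set" where
  "final_run_words c k l n = {w. length w = n \<and> suffix (replicate k c) w \<and>
     \<not> sublist (replicate k c) (butlast w) \<and> sublist (replicate l (\<not> c)) (butlast w)}"

lemma finite_final_run_words: "finite (final_run_words c k l n)"
  using finite_lists_length_eq[of "UNIV :: bool set" n]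
  by (rule rev_finite_subset) (auto simp: final_run_words_def)

text \<open>The index \<open>i\<close> is the number of letters \<open>\<not> c\<close>; it is at least \<open>l\<close> because these letters
  include a run of length \<open>l\<close>.\<close>

lemma final_run_words_eq:
  assumes "1 \<le> k" "1 \<le> l" "k + l \<le> n"
  shows "final_run_words c k l n =
    (\<Union>i\<in>{l..n - k}. (\<lambda>u. u @ replicate k c) ` pre_run_words c k l (n - k - i) i)" (is "?A = ?B")
proof -
  have "w \<in> ?A \<longleftrightarrow> w \<in> ?B" for w
  proof
    assume "w \<in> ?A"
    then obtain u where w: "w = u @ replicate k c" and len: "length w = n"
      and u: "u \<noteq> []" "last u \<noteq> c" "\<not> sublist (replicate k c) u" "sublist (replicate l (\<not> c)) u"
      using final_run_iff[OF assms(1,2), of c w] unfolding final_run_words_def by blast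
    have lu: "count_list u c + count_list u (\<not> c) = n - k"
      using len w length_eq_count_list[of u c] by simp
    have "l \<le> count_list u (\<not> c)"
      using u(4) by (auto simp: sublist_def count_list_replicate)
    with lu have "count_list u (\<not> c) \<in> {l..n - k}" "count_list u c = n - k - count_list u (\<not> c)" by auto
    with u w show "w \<in> ?B" unfolding pre_run_words_def by blast
  next
    assume "w \<in> ?B"
    then obtain i u where i: "i \<in> {l..n - k}" and w: "w = u @ replicate k c"
      and u: "u \<in> pre_run_words c k l (n - k - i) i" by blast
    from u have "count_list u c = n - k - i" "count_list u (\<not> c) = i"
      by (simp_all add: pre_run_words_def)
    with i have "length u = n - k"
      using length_eq_count_list[of u c] unfolding atLeastAtMost_iff by linarith
    with w assms(3) have "length w = n" by simp
    with u w final_run_iff[OF assms(1,2), of c w] show "w \<in> ?A"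
      unfolding final_run_words_def pre_run_words_def by blast
  qed
  then show ?thesis by blast
qed

lemma sum_final_run_words:
  fixes p :: "bool list \<Rightarrow> real"
  assumes "1 \<le> k" "1 \<le> l" "k + l \<le> n"
  shows "sum p (final_run_words c k l n) =
    (\<Sum>i = l..n - k. \<Sum>u\<in>pre_run_words c k l (n - k - i) i. p (u @ replicate k c))"
  unfolding final_run_words_eq[OF assms]
proof (subst sum.UNION_disjoint)
  show "\<forall>i\<in>{l..n - k}. \<forall>j\<in>{l..n - k}. i \<noteq> j \<longrightarrow>
      (\<lambda>u. u @ replicate k c) ` pre_run_words c k l (n - k - i) i \<inter>
      (\<lambda>u. u @ replicate k c) ` pre_run_words c k l (n - k - j) j = {}"
    unfolding pre_run_words_def by blast
  have "inj_on (\<lambda>u. u @ replicate k c) A" for A by (auto intro: inj_onI)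
  then show "(\<Sum>i = l..n - k. sum p ((\<lambda>u. u @ replicate k c) ` pre_run_words c k l (n - k - i) i)) =
      (\<Sum>i = l..n - k. \<Sum>u\<in>pre_run_words c k l (n - k - i) i. p (u @ replicate k c))"
    by (simp add: sum.reindex)
qed (auto simp: finite_pre_run_words)

section \<open>The law of the first trials\<close>

definition word_prob :: "real \<Rightarrow> real \<Rightarrow> bool list \<Rightarrow> real" where
  "word_prob q \<theta> w = \<theta> ^ count_list w True *
     (\<Prod>j = 1..count_list w False. 1 - \<theta> * q ^ (j - 1)) * q ^ inversions w"

lemma word_prob_snoc:
  "word_prob q \<theta> (w @ [b]) = word_prob q \<theta> w *
     (if b then \<theta> * q ^ count_list w False else 1 - \<theta> * q ^ count_list w False)"
  by (simp add: word_prob_def inversions_append power_add algebra_simps)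

context q_binary_trials
begin

abbreviation "trials n \<omega> \<equiv> word (\<lambda>j. X j \<omega>) n"

lemma trials_event: "{\<omega> \<in> space M. trials n \<omega> = w} \<in> events"
proof (induction n arbitrary: w)
  case 0
  show ?case by simp
next
  case (Suc n)
  have *: "{\<omega> \<in> space M. (X (Suc n) \<omega> = 1) = b} \<in> events" for b
    using measurable_sets[OF measurable_trial[of "Suc n"], of "{v. (v = 1) = b}"]
    by (simp add: vimage_def Int_def conj_commute)
  show ?case
  proof (cases w rule: rev_cases)
    case (snoc u b)
    have "{\<omega> \<in> space M. trials (Suc n) \<omega> = w} =
        {\<omega> \<in> space M. trials n \<omega> = u} \<inter> {\<omega> \<in> space M. (X (Suc n) \<omega> = 1) = b}"
      by (auto simp: snoc)
    with Suc * show ?thesis by auto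
  qed simp
qed

lemma prob_trials_in:
  assumes "finite A"
  shows "{\<omega> \<in> space M. trials n \<omega> \<in> A} \<in> events"
    and "\<P>(\<omega> in M. trials n \<omega> \<in> A) = (\<Sum>w\<in>A. \<P>(\<omega> in M. trials n \<omega> = w))"
proof -
  have eq: "{\<omega> \<in> space M. trials n \<omega> \<in> A} = (\<Union>w\<in>A. {\<omega> \<in> space M. trials n \<omega> = w})" by auto
  show "{\<omega> \<in> space M. trials n \<omega> \<in> A} \<in> events"
    unfolding eq using assms trials_event by auto
  show "\<P>(\<omega> in M. trials n \<omega> \<in> A) = (\<Sum>w\<in>A. \<P>(\<omega> in M. trials n \<omega> = w))"
    unfolding eq using assms trials_event
    by (intro finite_measure_finite_Union) (auto simp: disjoint_family_on_def)
qed

lemma trials_eq_iff: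
  assumes "\<omega> \<in> space M" "length w = n"
  shows "trials n \<omega> = w \<longleftrightarrow> (\<forall>l\<in>{1..<Suc n}. X l \<omega> = of_bool (w ! (l - 1)))"
proof -
  have "trials n \<omega> = w \<longleftrightarrow> (\<forall>i<n. (X (Suc i) \<omega> = 1) = w ! i)"
    using assms(2) by (auto simp: list_eq_iff_nth_eq word_def simp del: upt_Suc)
  also have "\<dots> \<longleftrightarrow> (\<forall>i<n. X (Suc i) \<omega> = of_bool (w ! i))"
  proof -
    have "(X (Suc i) \<omega> = 1) = b \<longleftrightarrow> X (Suc i) \<omega> = of_bool b" for i b
      using binary_trial[OF _ assms(1), of "Suc i"] by (cases b) auto
    then show ?thesis by blast
  qed
  also have "\<dots> \<longleftrightarrow> (\<forall>l\<in>{1..<Suc n}. X l \<omega> = of_bool (w ! (l - 1)))"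
    by (metis (no_types, lifting) Suc_diff_1 Suc_less_eq atLeastLessThan_iff diff_Suc_1 less_Suc_eq_0_disj One_nat_def Suc_le_eq zero_less_Suc)
  finally show ?thesis .
qed

text \<open>By the multiplication rule, one trial at a time. The conditional law is prescribed only for histories
  of positive probability; after a null history both sides vanish, whatever the factor for the next
  trial.\<close>

lemma prob_trials_eq: "length w = n \<Longrightarrow> \<P>(\<omega> in M. trials n \<omega> = w) = word_prob q \<theta> w"
proof (induction w arbitrary: n rule: rev_induct)
  case Nil
  then show ?case by (simp add: word_prob_def prob_space)
next
  case (snoc b u)
  define m where "m = length u"
  define x where "x l = (of_bool (u ! (l - 1)) :: nat)" for l
  have n: "n = Suc m" using snoc.prems by (simp add: m_def)
  have hist: "\<omega> \<in> space M \<Longrightarrow> trials m \<omega> = u \<longleftrightarrow> (\<forall>l\<in>{1..<n}. X l \<omega> = x l)" for \<omega>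
    unfolding n x_def by (rule trials_eq_iff) (simp_all add: m_def)
  have zeros: "card {l \<in> {1..<n}. x l = 0} = count_list u False"
  proof -
    have "{l \<in> {1..<n}. x l = 0} = Suc ` {i. i < length u \<and> \<not> u ! i}"
      by (auto simp: n x_def m_def image_iff gr0_conv_Suc Suc_le_eq)
    then show ?thesis
      by (simp add: card_image count_list_eq_length_filter length_filter_conv_card)
  qed
  have next_trial: "trials n \<omega> = u @ [b] \<longleftrightarrow> X n \<omega> = of_bool b \<and> (\<forall>l\<in>{1..<n}. X l \<omega> = x l)"
    if "\<omega> \<in> space M" for \<omega>
    using hist[OF that] binary_trial[of n, OF _ that] by (cases b) (auto simp: n)
  define h where "h = \<P>(\<omega> in M. \<forall>l\<in>{1..<n}. X l \<omega> = x l)"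
  have h: "h = word_prob q \<theta> u"
  proof -
    have "h = \<P>(\<omega> in M. trials m \<omega> = u)"
      unfolding h_def by (intro arg_cong[where f = prob] Collect_cong) (use hist in blast)
    then show ?thesis using snoc.IH[of m] by (simp add: m_def)
  qed
  have p: "\<P>(\<omega> in M. trials n \<omega> = u @ [b]) =
      \<P>(\<omega> in M. X n \<omega> = of_bool b \<and> (\<forall>l\<in>{1..<n}. X l \<omega> = x l))"
    by (intro arg_cong[where f = prob] Collect_cong) (use next_trial in blast)
  show ?case
  proof (cases "h > 0")
    case True
    have n1: "1 \<le> n" by (simp add: n)
    have "\<P>(\<omega> in M. X n \<omega> = of_bool b \<bar> \<forall>l\<in>{1..<n}. X l \<omega> = x l) =
        (if b then \<theta> * q ^ count_list u False else 1 - \<theta> * q ^ count_list u False)"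
      using cond_prob_failure[of n x, OF n1 True[unfolded h_def], unfolded zeros]
        cond_prob_success[of n x, OF n1 True[unfolded h_def], unfolded zeros]
      by (cases b) simp_all
    then show ?thesis
      using True unfolding p word_prob_snoc h[symmetric] cond_prob_def h_def by (simp add: field_simps)
  next
    case False
    then have h0: "h = 0" by (simp add: h_def zero_less_measure_iff)
    have "\<P>(\<omega> in M. trials n \<omega> = u @ [b]) \<le> \<P>(\<omega> in M. trials m \<omega> = u)"
      using trials_event by (intro finite_measure_mono) (auto simp: n)
    also have "\<dots> = 0" using snoc.IH[of m] h h0 by (simp add: m_def)
    finally show ?thesis using h h0 by (simp add: word_prob_snoc measure_le_0_iff)
  qed
qed

section \<open>The later waiting time\<close>

lemma waiting_times_iff_final_run:
  assumes "\<omega> \<in> space M" "0 < n"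
  shows "waiting_time (\<lambda>j. X j \<omega>) (of_bool c) k = enat n \<and>
      waiting_time (\<lambda>j. X j \<omega>) (of_bool (\<not> c)) l < enat n \<longleftrightarrow>
    trials n \<omega> \<in> final_run_words c k l n"
proof -
  have x: "\<forall>j\<ge>1. X j \<omega> \<in> {0, 1}"
    using binary_trial[OF _ assms(1)] by blast
  show ?thesis
    unfolding final_run_words_def waiting_time_word[of "\<lambda>j. X j \<omega>", OF x assms(2)] by simp
qed

lemma PL1_event_eq:
  assumes "0 < n"
  shows "{\<omega> \<in> space M. T1 X k1 \<omega> = enat n \<and> T0 X k2 \<omega> < enat n} =
    {\<omega> \<in> space M. trials n \<omega> \<in> final_run_words True k1 k2 n}"
  using waiting_times_iff_final_run[OF _ assms, of _ True k1 k2] by (auto simp: T1_def T0_def)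

lemma PL0_event_eq:
  assumes "0 < n"
  shows "{\<omega> \<in> space M. T0 X k2 \<omega> = enat n \<and> T1 X k1 \<omega> < enat n} =
    {\<omega> \<in> space M. trials n \<omega> \<in> final_run_words False k2 k1 n}"
  using waiting_times_iff_final_run[OF _ assms, of _ False k2 k1] by (auto simp: T1_def T0_def)

lemma prob_final_run:
  assumes "1 \<le> k" "1 \<le> l" "k + l \<le> n"
  shows "\<P>(\<omega> in M. trials n \<omega> \<in> final_run_words c k l n) =
    (\<Sum>i = l..n - k. \<Sum>u\<in>pre_run_words c k l (n - k - i) i. word_prob q \<theta> (u @ replicate k c))"
proof -
  have "\<P>(\<omega> in M. trials n \<omega> \<in> final_run_words c k l n) =
      sum (word_prob q \<theta>) (final_run_words c k l n)"
    unfolding prob_trials_in(2)[OF finite_final_run_words]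
    by (intro sum.cong refl prob_trials_eq) (simp add: final_run_words_def)
  then show ?thesis using sum_final_run_words[OF assms] by simp
qed

text \<open>The trial at which both runs would end cannot be both a success and a failure.\<close>

lemma T1_neq_T0:
  assumes "\<omega> \<in> space M" "0 < n" "1 \<le> k1" "1 \<le> k2"
  shows "\<not> (T1 X k1 \<omega> = enat n \<and> T0 X k2 \<omega> = enat n)"
proof
  assume "T1 X k1 \<omega> = enat n \<and> T0 X k2 \<omega> = enat n"
  then have "run_ends_at (\<lambda>j. X j \<omega>) 1 k1 n" "run_ends_at (\<lambda>j. X j \<omega>) 0 k2 n"
    by (simp_all add: T1_def T0_def waiting_time_eq_iff)
  moreover have "n \<in> {n - k1 + 1..n}" "n \<in> {n - k2 + 1..n}" using assms by auto
  ultimately have "X n \<omega> = 1" "X n \<omega> = 0" unfolding run_ends_at_def by blast+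
  then show False by simp
qed

lemma prob_WL:
  assumes "0 < n" "1 \<le> k1" "1 \<le> k2"
  shows "\<P>(\<omega> in M. WL X k1 k2 \<omega> = enat n) = PL1 M X k1 k2 n + PL0 M X k1 k2 n"
proof -
  have "{\<omega> \<in> space M. WL X k1 k2 \<omega> = enat n} =
      {\<omega> \<in> space M. T1 X k1 \<omega> = enat n \<and> T0 X k2 \<omega> < enat n} \<union>
      {\<omega> \<in> space M. T0 X k2 \<omega> = enat n \<and> T1 X k1 \<omega> < enat n}"
  proof -
    have "max a b = c \<longleftrightarrow> (a = c \<and> b < c) \<or> (b = c \<and> a < c)" if "\<not> (a = c \<and> b = c)" for a b c :: enat
      using that by (cases a b rule: linorder_cases) (auto simp: max_def)
    from this[OF T1_neq_T0[OF _ assms]] show ?thesis unfolding WL_def by blast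
  qed
  moreover have "{\<omega> \<in> space M. T1 X k1 \<omega> = enat n \<and> T0 X k2 \<omega> < enat n} \<in> events"
    "{\<omega> \<in> space M. T0 X k2 \<omega> = enat n \<and> T1 X k1 \<omega> < enat n} \<in> events"
    unfolding PL1_event_eq[OF assms(1)] PL0_event_eq[OF assms(1)] by (rule prob_trials_in(1)[OF finite_final_run_words])+
  ultimately show ?thesis
    unfolding PL1_def PL0_def by (simp add: finite_measure_Union disjoint_iff)
qed

end

lemma word_prob_then_successes:
  assumes "u \<in> pre_run_words True k l m i"
  shows "word_prob q \<theta> (u @ replicate k True) =
    \<theta> ^ (m + k) * q ^ (i * k) * (\<Prod>j = 1..i. 1 - \<theta> * q ^ (j - 1)) * q ^ inversions u"
  using assms
  by (simp add: pre_run_words_def word_prob_def count_list_replicate inversions_append power_add mult_ac)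

lemma word_prob_then_failures:
  assumes "u \<in> pre_run_words False k l m i"
  shows "word_prob q \<theta> (u @ replicate k False) =
    \<theta> ^ i * (\<Prod>j = 1..m + k. 1 - \<theta> * q ^ (j - 1)) * q ^ inversions u"
  using assms
  by (simp add: pre_run_words_def word_prob_def count_list_replicate inversions_append)

theorem theorem3p2:
  fixes M :: "'a measure" and X :: "nat \<Rightarrow> 'a \<Rightarrow> nat"
    and q \<theta> :: real and k1 k2 n :: nat
  assumes "0 \<le> \<theta>" and "\<theta> \<le> 1" and "0 < q" and "q < 1"
    and "q_binary_trials M X q \<theta>"
    and "k1 \<ge> 1" and "k2 \<ge> 1" and "n \<ge> k1 + k2"
  shows "\<P>(\<omega> in M. WL X k1 k2 \<omega> = enat n) = PL1 M X k1 k2 n + PL0 M X k1 k2 n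
    \<and> PL1 M X k1 k2 n =
        (\<Sum>i = k2..n - k1. \<theta> ^ (n - i) * q ^ (i * k1) * (\<Prod>j = 1..i. 1 - \<theta> * q ^ (j - 1)) *
          (\<Sum>s = 1..i - k2 + 1. E q k1 k2 (n - k1 - i) i s + F q k1 k2 (n - k1 - i) i s))
    \<and> PL0 M X k1 k2 n =
        (\<Sum>i = k1..n - k2. \<theta> ^ i * (\<Prod>j = 1..n - i. 1 - \<theta> * q ^ (j - 1)) *
          (\<Sum>s = 1..i - k1 + 1. G q k1 k2 i (n - k2 - i) s + H q k1 k2 i (n - k2 - i) s))"
proof (intro conjI)
  interpret q_binary_trials M X q \<theta> by fact
  have n: "0 < n" "k2 + k1 \<le> n" using assms by auto
  show "\<P>(\<omega> in M. WL X k1 k2 \<omega> = enat n) = PL1 M X k1 k2 n + PL0 M X k1 k2 n"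
    by (rule prob_WL[OF n(1) assms(6,7)])
  show "PL1 M X k1 k2 n =
        (\<Sum>i = k2..n - k1. \<theta> ^ (n - i) * q ^ (i * k1) * (\<Prod>j = 1..i. 1 - \<theta> * q ^ (j - 1)) *
          (\<Sum>s = 1..i - k2 + 1. E q k1 k2 (n - k1 - i) i s + F q k1 k2 (n - k1 - i) i s))"
    unfolding PL1_def PL1_event_eq[OF n(1)] prob_final_run[OF assms(6-8)] E_F_words[OF assms(6,7), symmetric]
      sum_distrib_left
  proof (intro sum.cong refl)
    fix i u assume i: "i \<in> {k2..n - k1}" and u: "u \<in> pre_run_words True k1 k2 (n - k1 - i) i"
    from i assms(8) have "n - i = n - k1 - i + k1" by auto
    then show "word_prob q \<theta> (u @ replicate k1 True) =
        \<theta> ^ (n - i) * q ^ (i * k1) * (\<Prod>j = 1..i. 1 - \<theta> * q ^ (j - 1)) * q ^ inversions u"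
      using word_prob_then_successes[OF u] by simp
  qed
  show "PL0 M X k1 k2 n =
        (\<Sum>i = k1..n - k2. \<theta> ^ i * (\<Prod>j = 1..n - i. 1 - \<theta> * q ^ (j - 1)) *
          (\<Sum>s = 1..i - k1 + 1. G q k1 k2 i (n - k2 - i) s + H q k1 k2 i (n - k2 - i) s))"
    unfolding PL0_def PL0_event_eq[OF n(1)] prob_final_run[OF assms(7,6) n(2)] G_H_words[OF assms(6,7), symmetric]
      sum_distrib_left
  proof (intro sum.cong refl)
    fix i u assume i: "i \<in> {k1..n - k2}" and u: "u \<in> pre_run_words False k2 k1 (n - k2 - i) i"
    from i assms(8) have "n - i = n - k2 - i + k2" by auto
    then show "word_prob q \<theta> (u @ replicate k2 False) =
        \<theta> ^ i * (\<Prod>j = 1..n - i. 1 - \<theta> * q ^ (j - 1)) * q ^ inversions u"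
      using word_prob_then_failures[OF u] by simp
  qed
qed

end
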